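(* For all integers $k\geq 1$ and $n\geq 2$ there is a $k$-connected (finite, simple) graph $G_{n,k}$ such that $\beta(G_{n,k})\leq 2k$ and $\beta(G_{n,k}\,\square\,G_{n,k})\geq n$.
   Context: $d(v,w)$ denotes shortest-path distance. A vertex $x$ resolves $v,w$ if $d(v,x)\neq d(w,x)$; a set $S$ resolves a graph if every pair of distinct vertices is resolved by some vertex of $S$; $\beta(G)$ (the metric dimension) is the minimum size of a resolving set of $G$. The cartesian product $G\,\square\,H$ has vertex set $V(G)\times V(H)$, with $(a,v)\sim(b,w)$ iff ($a=b$ and $vw\in E(H)$) or ($v=w$ and $ab\in E(G)$). *)

theory Defs
  imports "Graph_Theory.Shortest_Path" "Graph_Theory.Digraph_Component"
begin

text \<open>
  Finite simple graphs are the \<^locale>\<open>pair_graph\<close>s of the library: finite, loop-free, symmetric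
  digraphs without parallel arcs. An undirected edge $uv$ is the pair of arcs $(u,v)$, $(v,u)$.
\<close>

text \<open>
  The shortest-path distance is the library's minimum walk cost for unit arc weights, so that the
  cost of a walk is its length. Its value is infinite for vertices in different components.
\<close>

definition graph_dist :: "'a pair_pre_digraph \<Rightarrow> 'a \<Rightarrow> 'a \<Rightarrow> ereal" where
  "graph_dist G u v = wf_digraph.\<mu> (with_proj G) (\<lambda>_. 1) u v"

definition resolves :: "'a pair_pre_digraph \<Rightarrow> 'a \<Rightarrow> 'a \<Rightarrow> 'a \<Rightarrow> bool" where
  "resolves G x v w \<longleftrightarrow> graph_dist G v x \<noteq> graph_dist G w x"

definition resolving_set :: "'a pair_pre_digraph \<Rightarrow> 'a set \<Rightarrow> bool" where
  "resolving_set G S \<longleftrightarrow> S \<subseteq> pverts G \<and>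
     (\<forall>v\<in>pverts G. \<forall>w\<in>pverts G. v \<noteq> w \<longrightarrow> (\<exists>x\<in>S. resolves G x v w))"

text \<open>
  The minimum is attained for every finite simple graph, since the set of all vertices is
  resolving (see \<open>resolving_set_pverts\<close> below).
\<close>

definition metric_dim :: "'a pair_pre_digraph \<Rightarrow> nat" where
  "metric_dim G = (LEAST m. \<exists>S. finite S \<and> resolving_set G S \<and> card S = m)"

definition cartesian_product ::
  "'a pair_pre_digraph \<Rightarrow> 'b pair_pre_digraph \<Rightarrow> ('a \<times> 'b) pair_pre_digraph" (infixr \<open>\<box>\<close> 70) where
  "G \<box> H = \<lparr> pverts = pverts G \<times> pverts H,
     parcs = {((a, v), (b, w)). (a = b \<and> a \<in> pverts G \<and> (v, w) \<in> parcs H) \<or>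
                               (v = w \<and> v \<in> pverts H \<and> (a, b) \<in> parcs G)} \<rparr>"

definition delete_verts :: "'a pair_pre_digraph \<Rightarrow> 'a set \<Rightarrow> 'a pair_pre_digraph" where
  "delete_verts G X = \<lparr> pverts = pverts G - X,
     parcs = {(u, v) \<in> parcs G. u \<notin> X \<and> v \<notin> X} \<rparr>"

text \<open>
  The usual convention for $k$-connectedness: more than $k$ vertices, and no set of fewer than $k$
  vertices separates the graph. In particular the complete graph on $k+1$ vertices is
  $k$-connected.
\<close>

definition k_connected :: "nat \<Rightarrow> 'a pair_pre_digraph \<Rightarrow> bool" where
  "k_connected k G \<longleftrightarrow> k < card (pverts G) \<and>
     (\<forall>X \<subseteq> pverts G. card X < k \<longrightarrow>
        Digraph_Component.connected (with_proj (delete_verts G X)))"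

lemma pair_graph_cartesian_product:
  assumes "pair_graph G" "pair_graph H"
  shows "pair_graph (G \<box> H)"
proof -
  interpret G: pair_graph G by fact
  interpret H: pair_graph H by fact
  have sub: "parcs (G \<box> H) \<subseteq> (pverts G \<times> pverts H) \<times> (pverts G \<times> pverts H)"
    by (auto simp: cartesian_product_def dest: G.in_arcsD1 G.in_arcsD2 H.in_arcsD1 H.in_arcsD2)
  have fin: "finite (pverts G \<times> pverts H)"
    by (simp add: G.pair_finite_verts H.pair_finite_verts)
  have symG: "(b, a) \<in> parcs G" if "(a, b) \<in> parcs G" for a b
    using G.pair_sym_arcs that by (auto simp: symmetric_def sym_def)
  have symH: "(b, a) \<in> parcs H" if "(a, b) \<in> parcs H" for a b
    using H.pair_sym_arcs that by (auto simp: symmetric_def sym_def)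
  show ?thesis
  proof
    show "finite (parcs (G \<box> H))"
      using finite_subset[OF sub] fin by blast
    show "finite (pverts (G \<box> H))" using fin by (simp add: cartesian_product_def)
    show "symmetric (with_proj (G \<box> H))"
      by (auto simp: symmetric_def sym_def cartesian_product_def intro: symG symH)
  next
    fix e assume "e \<in> parcs (G \<box> H)"
    then show "fst e \<noteq> snd e"
      by (auto simp: cartesian_product_def dest: G.pair_no_loops H.pair_no_loops)
  next
    fix e assume "e \<in> parcs (G \<box> H)"
    with sub have "e \<in> (pverts G \<times> pverts H) \<times> (pverts G \<times> pverts H)" by blast
    then show "fst e \<in> pverts (G \<box> H)" "snd e \<in> pverts (G \<box> H)"
      by (auto simp: cartesian_product_def)
  qed
qed

lemma resolving_set_pverts:
  assumes "pair_graph G"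
  shows "resolving_set G (pverts G)"
proof -
  interpret G: pair_graph G by fact
  have cost: "G.awalk_cost (\<lambda>_. 1) p = real (length p)" for p :: "('a \<times> 'a) list"
    by (induct p) auto
  have zero: "graph_dist G v v \<le> 0" if "v \<in> pverts G" for v
    using G.min_cost_le_walk_cost[of v "[]" v "\<lambda>_. 1"] that
    by (simp add: graph_dist_def cost G.awalk_Nil_iff zero_ereal_def)
  have one: "1 \<le> graph_dist G w v" if "w \<noteq> v" for v w
    unfolding graph_dist_def G.\<mu>_def
  proof (rule INF_greatest)
    fix p assume "p \<in> {p. G.awalk w p v}"
    then have "p \<noteq> []" using that by (auto simp: G.awalk_Nil_iff)
    then have "1 \<le> length p" by (cases p) auto
    then show "1 \<le> ereal (G.awalk_cost (\<lambda>_. 1) p)"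
      by (simp add: cost one_ereal_def)
  qed
  have "graph_dist G v v \<noteq> graph_dist G w v" if "v \<in> pverts G" "v \<noteq> w" for v w
  proof
    assume "graph_dist G v v = graph_dist G w v"
    then have "(1::ereal) \<le> 0" using zero[OF that(1)] one[of w v] that(2) by (metis order_trans)
    then show False by simp
  qed
  then show ?thesis unfolding resolving_set_def resolves_def by blast
qed

end

theory Submission
  imports Defs
begin

text \<open>
  Let $T$ be the comb consisting of a spine path on $n$ vertices with a tooth, a path of length $k$,
  hanging off each spine vertex, and let $G$ be its $k$-th power, so that
  $d_G = \lceil d_T / k \rceil$. Consecutive teeth of $G$ are cliques joined by $k$ disjoint edges,
  which makes $G$ $k$-connected. The $k$ proper vertices of the first tooth determine the sum of the
  spine coordinate and the height of a vertex, those of the last tooth determine their difference,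
  so these $2k$ vertices resolve $G$. Finally, if $l_i$ is the end and $v_i$ the foot of the $i$-th
  tooth, then $d_G(l_i, x) = d_G(v_i, x) + 1$ unless $x$ lies on that tooth and off the spine. Hence
  a vertex $(x, y)$ of $G \mathbin\square G$ resolves $(l_i, v_j)$ and $(v_i, l_j)$ only if $x$
  lies on tooth $i$ or $y$ lies on tooth $j$, and a resolving set has to meet all
  $n$ teeth in one of its two projections.
\<close>

section \<open>Distance functions and metric dimension\<close>

text \<open>A local certificate for shortest-path distance: no arc decreases \<open>f\<close> by
  more than one, and some arc decreases it by exactly one. Values in \<open>nat\<close> keep the
  later arithmetic away from \<open>ereal\<close>.\<close>

definition path_metric :: "'a pair_pre_digraph \<Rightarrow> ('a \<Rightarrow> 'a \<Rightarrow> nat) \<Rightarrow> bool" where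
  "path_metric G f \<longleftrightarrow> (\<forall>v\<in>pverts G. f v v = 0) \<and>
     (\<forall>(u, w)\<in>parcs G. \<forall>v\<in>pverts G. f u v \<le> Suc (f w v)) \<and>
     (\<forall>u\<in>pverts G. \<forall>v\<in>pverts G. u \<noteq> v \<longrightarrow> (\<exists>w. (u, w) \<in> parcs G \<and> f u v = Suc (f w v)))"

lemma path_metric_refl: "path_metric G f \<Longrightarrow> v \<in> pverts G \<Longrightarrow> f v v = 0"
  by (simp add: path_metric_def)

lemma path_metric_arc:
  "path_metric G f \<Longrightarrow> (u, w) \<in> parcs G \<Longrightarrow> v \<in> pverts G \<Longrightarrow> f u v \<le> Suc (f w v)"
  by (force simp: path_metric_def)

lemma path_metric_step:
  assumes "path_metric G f" "u \<in> pverts G" "v \<in> pverts G" "u \<noteq> v"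
  obtains w where "(u, w) \<in> parcs G" "f u v = Suc (f w v)"
  using assms unfolding path_metric_def by blast

text \<open>A walk from \<open>u\<close> to \<open>v\<close> must bring \<open>f\<close> down to 0
  and each arc lowers it by at most one, so its length is at least \<open>f u v\<close>. Following
  arcs that lower \<open>f\<close> yields a walk of exactly that length.\<close>

lemma graph_dist_path_metric:
  assumes "pair_wf_digraph G" and f: "path_metric G f"
    and "u \<in> pverts G" "v \<in> pverts G"
  shows "graph_dist G u v = ereal (real (f u v))"
proof -
  interpret pair_wf_digraph G by fact
  have cost: "awalk_cost (\<lambda>_. 1) p = real (length p)" for p :: "('a \<times> 'a) list"
    by (induct p) auto
  have lower: "f u v \<le> length p" if "awalk u p v" for u p
    using that
  proof (induct p arbitrary: u)
    case Nil
    then show ?case using path_metric_refl[OF f] by (auto simp: awalk_Nil_iff)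
  next
    case (Cons e p)
    obtain a b where e: "e = (a, b)" by fastforce
    then have "a = u" "(u, b) \<in> parcs G" "awalk b p v"
      using Cons.prems by (auto simp: awalk_Cons_iff)
    then show ?case
      using Cons.hyps[of b] path_metric_arc[OF f, of u b v] assms(4) by fastforce
  qed
  have upper: "\<exists>p. awalk u p v \<and> length p = f u v" if "u \<in> pverts G" for u
    using that
  proof (induct "f u v" arbitrary: u rule: less_induct)
    case less
    show ?case
    proof (cases "u = v")
      case True
      then show ?thesis
        using less.prems path_metric_refl[OF f] by (intro exI[of _ "[]"]) (simp add: awalk_Nil_iff)
    next
      case False
      then obtain w where w: "(u, w) \<in> parcs G" "f u v = Suc (f w v)"
        using path_metric_step[OF f less.prems assms(4)] by blast
      then obtain p where "awalk w p v" "length p = f w v"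
        using less.hyps[of w] in_arcsD2 by auto
      then show ?thesis
        using w by (intro exI[of _ "(u, w) # p"]) (simp add: awalk_Cons_iff)
    qed
  qed
  obtain p where "awalk u p v" "length p = f u v" using upper assms(3) by blast
  then have "graph_dist G u v \<le> ereal (real (f u v))"
    using min_cost_le_walk_cost[of u p v "\<lambda>_. 1"] by (simp add: graph_dist_def cost)
  moreover have "ereal (real (f u v)) \<le> graph_dist G u v"
    unfolding graph_dist_def \<mu>_def by (rule INF_greatest) (simp add: cost lower)
  ultimately show ?thesis by (rule antisym)
qed

text \<open>An arc changes a single coordinate, so the two distances add up. A descending arc moves
  in the first coordinate until it agrees with the target, then in the second.\<close>

lemma path_metric_cartesian_product:
  assumes "pair_wf_digraph G" "pair_wf_digraph H" and f: "path_metric G f" and g: "path_metric H g"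
  shows "path_metric (G \<box> H) (\<lambda>(a, v) (b, w). f a b + g v w)"
proof -
  have "\<exists>c. (u, c) \<in> parcs (G \<box> H) \<and>
      f (fst u) (fst v) + g (snd u) (snd v) = Suc (f (fst c) (fst v) + g (snd c) (snd v))"
    if u: "u \<in> pverts (G \<box> H)" and v: "v \<in> pverts (G \<box> H)" and "u \<noteq> v" for u v
  proof (cases "fst u = fst v")
    case True
    then have "snd u \<noteq> snd v" using \<open>u \<noteq> v\<close> by (simp add: prod_eq_iff)
    moreover have "snd u \<in> pverts H" "snd v \<in> pverts H"
      using u v by (auto simp: cartesian_product_def)
    ultimately obtain w where "(snd u, w) \<in> parcs H" "g (snd u) (snd v) = Suc (g w (snd v))"
      using path_metric_step[OF g] by blast
    then show ?thesis
      using u by (intro exI[of _ "(fst u, w)"]) (auto simp: cartesian_product_def)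
  next
    case False
    moreover have "fst u \<in> pverts G" "fst v \<in> pverts G"
      using u v by (auto simp: cartesian_product_def)
    ultimately obtain w where "(fst u, w) \<in> parcs G" "f (fst u) (fst v) = Suc (f w (fst v))"
      using path_metric_step[OF f] by blast
    then show ?thesis
      using u by (intro exI[of _ "(w, snd u)"]) (auto simp: cartesian_product_def)
  qed
  then show ?thesis
    using path_metric_refl[OF f] path_metric_refl[OF g] path_metric_arc[OF f] path_metric_arc[OF g]
    unfolding path_metric_def[of "G \<box> H"]
    by (auto simp: cartesian_product_def split_beta)
qed

lemma resolves_path_metric:
  assumes "pair_wf_digraph G" "path_metric G f" "x \<in> pverts G" "v \<in> pverts G" "w \<in> pverts G"
  shows "resolves G x v w \<longleftrightarrow> f v x \<noteq> f w x"
  by (simp add: resolves_def graph_dist_path_metric[OF assms(1,2)] assms(3-))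

lemma metric_dim_le:
  assumes "finite S" "resolving_set G S"
  shows "metric_dim G \<le> card S"
  unfolding metric_dim_def by (rule Least_le) (use assms in blast)

lemma metric_dim_attained:
  assumes "pair_graph G"
  obtains S where "finite S" "resolving_set G S" "card S = metric_dim G"
proof -
  interpret pair_graph G by fact
  have "\<exists>S. finite S \<and> resolving_set G S \<and> card S = card (pverts G)"
    using resolving_set_pverts[OF assms] pair_finite_verts by blast
  then have "\<exists>S. finite S \<and> resolving_set G S \<and> card S = metric_dim G"
    unfolding metric_dim_def by (rule LeastI)
  then show thesis using that by blast
qed

section \<open>Lower bounds for the metric dimension of a cartesian square\<close>

lemma card_ge_if_meets_disjoint:
  fixes A :: "nat \<Rightarrow> 'b set"
  assumes "finite S" "disjoint_family_on A {..<n}" "\<And>i. i < n \<Longrightarrow> \<exists>s\<in>S. h s \<in> A i"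
  shows "n \<le> card S"
proof -
  obtain c where c: "\<And>i. i < n \<Longrightarrow> c i \<in> S \<and> h (c i) \<in> A i"
    using assms(3) by metis
  have "inj_on c {..<n}"
  proof (rule inj_onI, rule ccontr)
    fix i j assume "i \<in> {..<n}" "j \<in> {..<n}" "c i = c j" "i \<noteq> j"
    then show False
      using c[of i] c[of j] assms(2) by (auto simp: disjoint_family_on_def)
  qed
  then have "card {..<n} \<le> card S"
    using c assms(1) by (intro card_inj_on_le) auto
  then show ?thesis by simp
qed

text \<open>If \<open>fst s\<close> avoids \<open>A i\<close> and \<open>snd s\<close> avoids
  \<open>A j\<close>, then \<open>(l i, v j)\<close> and \<open>(v i, l j)\<close> are both at
  distance \<open>f (v i) (fst s) + f (v j) (snd s) + 1\<close> from \<open>s\<close>, which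
  therefore does not resolve them.\<close>

lemma metric_dim_square_ge:
  fixes A :: "nat \<Rightarrow> 'a set"
  assumes G: "pair_graph G" and f: "path_metric G f"
    and A: "disjoint_family_on A {..<n}"
    and l: "\<And>i. i < n \<Longrightarrow> l i \<in> pverts G" and v: "\<And>i. i < n \<Longrightarrow> v i \<in> pverts G"
    and ne: "\<And>i. i < n \<Longrightarrow> l i \<noteq> v i"
    and diff: "\<And>i x. i < n \<Longrightarrow> x \<in> pverts G \<Longrightarrow> x \<notin> A i \<Longrightarrow> f (l i) x = Suc (f (v i) x)"
  shows "n \<le> metric_dim (G \<box> G)"
proof -
  interpret G: pair_graph G by fact
  have GG: "pair_graph (G \<box> G)" by (rule pair_graph_cartesian_product[OF G G])
  interpret GG: pair_graph "G \<box> G" by fact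
  obtain S where S: "finite S" "resolving_set (G \<box> G) S" "card S = metric_dim (G \<box> G)"
    using metric_dim_attained[OF GG] .
  have "(\<exists>s\<in>S. fst s \<in> A i) \<or> (\<exists>s\<in>S. snd s \<in> A j)" if "i < n" "j < n" for i j
  proof -
    have V: "(l i, v j) \<in> pverts (G \<box> G)" "(v i, l j) \<in> pverts (G \<box> G)"
      using that l v by (auto simp: cartesian_product_def)
    moreover have "(l i, v j) \<noteq> (v i, l j)" using ne that by auto
    ultimately obtain s where s: "s \<in> S" "resolves (G \<box> G) s (l i, v j) (v i, l j)"
      using S(2) unfolding resolving_set_def by blast
    have sV: "s \<in> pverts (G \<box> G)" using s(1) S(2) by (auto simp: resolving_set_def)
    have "f (l i) (fst s) + f (v j) (snd s) \<noteq> f (v i) (fst s) + f (l j) (snd s)"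
      using s(2) resolves_path_metric[OF GG.pair_wf_digraph_axioms
          path_metric_cartesian_product[OF G.pair_wf_digraph_axioms G.pair_wf_digraph_axioms f f]
          sV V]
      by (simp add: split_beta)
    moreover have "fst s \<in> pverts G" "snd s \<in> pverts G"
      using sV by (auto simp: cartesian_product_def)
    ultimately have "fst s \<in> A i \<or> snd s \<in> A j"
      using diff[of i "fst s"] diff[of j "snd s"] that by linarith
    then show ?thesis using s(1) by blast
  qed
  \<comment> \<open>If the first projections miss some \<open>A i\<close>, that \<open>i\<close>
    paired with each \<open>j\<close> forces the second projections to meet every
    \<open>A j\<close>.\<close>
  then have "(\<forall>i<n. \<exists>s\<in>S. fst s \<in> A i) \<or> (\<forall>j<n. \<exists>s\<in>S. snd s \<in> A j)" by blast
  then show ?thesis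
    using card_ge_if_meets_disjoint[OF S(1) A, of fst] card_ge_if_meets_disjoint[OF S(1) A, of snd]
      S(3) by auto
qed

section \<open>Powers of combs\<close>

text \<open>
  The vertex at height $h \le k$ on the tooth with spine coordinate $p$ is the number
  $p (k + 1) + h$.
\<close>

definition node :: "nat \<Rightarrow> nat \<Rightarrow> nat \<Rightarrow> nat" where
  "node k p h = p * Suc k + h"

abbreviation col :: "nat \<Rightarrow> nat \<Rightarrow> nat" where "col k v \<equiv> v div Suc k"
abbreviation ht :: "nat \<Rightarrow> nat \<Rightarrow> nat" where "ht k v \<equiv> v mod Suc k"

section \<open>The tree metric of the comb\<close>

definition nat_dist :: "nat \<Rightarrow> nat \<Rightarrow> nat" where
  "nat_dist a b = (a - b) + (b - a)"

text \<open>This is the distance in the tree \<open>T\<close>: between different teeth the path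
  descends to the spine, runs along it and climbs again.\<close>

definition comb_dist :: "nat \<Rightarrow> nat \<Rightarrow> nat \<Rightarrow> nat" where
  "comb_dist k u v = (if col k u = col k v then nat_dist (ht k u) (ht k v)
     else ht k u + ht k v + nat_dist (col k u) (col k v))"

lemma col_node [simp]: "h \<le> k \<Longrightarrow> col k (node k p h) = p"
  unfolding node_def by (subst div_mult_self3) simp_all

lemma ht_node [simp]: "h \<le> k \<Longrightarrow> ht k (node k p h) = h"
  unfolding node_def by (metis le_imp_less_Suc mod_less mod_mult_self3)

lemma ht_le: "ht k v \<le> k"
  using less_Suc_eq_le by fastforce

lemma node_col_ht [simp]: "node k (col k v) (ht k v) = v"
  unfolding node_def by (rule div_mult_mod_eq)

lemma comb_vertex_eqI: "col k u = col k v \<Longrightarrow> ht k u = ht k v \<Longrightarrow> u = v"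
  by (metis node_col_ht)

lemma nat_dist_commute: "nat_dist a b = nat_dist b a"
  by (simp add: nat_dist_def)

lemma nat_dist_simps [simp]: "nat_dist a a = 0" "nat_dist 0 a = a" "nat_dist a 0 = a"
  by (simp_all add: nat_dist_def)

lemma nat_dist_triangle: "nat_dist a b \<le> nat_dist a c + nat_dist c b"
  unfolding nat_dist_def by arith

lemma nat_dist_le_add: "nat_dist a b \<le> a + b"
  unfolding nat_dist_def by arith

lemma le_nat_dist_add: "a \<le> nat_dist a b + b"
  unfolding nat_dist_def by arith

lemma nat_dist_le: "a \<le> k \<Longrightarrow> b \<le> k \<Longrightarrow> nat_dist a b \<le> k"
  unfolding nat_dist_def by arith

lemma nat_dist_eq_0_iff [simp]: "nat_dist a b = 0 \<longleftrightarrow> a = b"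
  unfolding nat_dist_def by arith

lemma comb_dist_commute: "comb_dist k u v = comb_dist k v u"
  by (simp add: comb_dist_def nat_dist_commute)

lemma comb_dist_self [simp]: "comb_dist k v v = 0"
  by (simp add: comb_dist_def)

lemma comb_dist_triangle: "comb_dist k u v \<le> comb_dist k u w + comb_dist k w v"
proof -
  define p h q g r t where "p = col k u" "h = ht k u" "q = col k v" "g = ht k v"
    "r = col k w" "t = ht k w"
  then have "comb_dist k u v = (if p = q then nat_dist h g else h + g + nat_dist p q)"
    "comb_dist k u w = (if p = r then nat_dist h t else h + t + nat_dist p r)"
    "comb_dist k w v = (if r = q then nat_dist t g else t + g + nat_dist r q)"
    by (simp_all add: comb_dist_def)
  \<comment> \<open>\<open>nat_dist_le_add\<close> serves the case where only \<open>w\<close> is on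
    another tooth; the two instances of \<open>le_nat_dist_add\<close> serve the cases where
    \<open>w\<close> shares its tooth with exactly one of \<open>u\<close> and
    \<open>v\<close>.\<close>
  moreover note nat_dist_triangle[of p q r] nat_dist_triangle[of h g t] nat_dist_le_add[of h g]
    le_nat_dist_add[of h t] le_nat_dist_add[of g t]
  ultimately show ?thesis by (auto simp: nat_dist_commute)
qed

lemma comb_dist_col_le: "col k u = col k v \<Longrightarrow> comb_dist k u v \<le> k"
  by (simp add: comb_dist_def nat_dist_le ht_le)

lemma comb_dist_pos: "u \<noteq> v \<Longrightarrow> 0 < comb_dist k u v"
  using comb_vertex_eqI[of u k v] by (metis comb_dist_def add_is_0 nat_dist_eq_0_iff neq0_conv)

text \<open>The vertex \<open>w\<close> is found by walking \<open>k\<close> steps along the tree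
  path from \<open>u\<close> to \<open>v\<close>. A tooth has diameter at most \<open>k\<close>, so
  \<open>u\<close> and \<open>v\<close> lie on different teeth and the path uses the spine.\<close>

lemma comb_dist_geodesic:
  assumes "k < comb_dist k u v" "col k u < n" "col k v < n"
  obtains w where "col k w < n" "comb_dist k u w = k" "comb_dist k w v = comb_dist k u v - k"
proof -
  define p h q g where "p = col k u" "h = ht k u" "q = col k v" "g = ht k v"
  note defs = this
  have "p \<noteq> q" using assms(1) comb_dist_col_le[of u k v] defs by auto
  have n: "p < n" "q < n" using assms defs by auto
  have h: "h \<le> k" using ht_le defs by auto
  have d: "comb_dist k u v = h + g + nat_dist p q"
    using \<open>p \<noteq> q\<close> by (simp add: comb_dist_def defs)
  have du: "comb_dist k u (node k r t) = (if p = r then nat_dist h t else h + t + nat_dist p r)"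
    and dv: "comb_dist k (node k r t) v = (if r = q then nat_dist t g else t + g + nat_dist r q)"
    if "t \<le> k" for r t
    using that by (simp_all add: comb_dist_def defs)
  show thesis
  proof (cases "k - h \<le> nat_dist p q")
    case True
    \<comment> \<open>After \<open>h\<close> steps down, the remaining \<open>k - h\<close> steps
      end on the spine at coordinate \<open>r\<close>.\<close>
    define r where "r = (if p < q then p + (k - h) else p - (k - h))"
    have r: "nat_dist p r = k - h" "nat_dist r q = nat_dist p q - (k - h)" "r < n"
      using True \<open>p \<noteq> q\<close> n unfolding r_def nat_dist_def by (auto split: if_splits)
    show thesis
    proof (rule that)
      show "col k (node k r 0) < n" using r by simp
      show "comb_dist k u (node k r 0) = k"
        using du[of 0 r] r h by (cases "p = r") auto
      show "comb_dist k (node k r 0) v = comb_dist k u v - k"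
        using dv[of 0 r] r h True d by (cases "r = q") auto
    qed
  next
    case False
    \<comment> \<open>The spine is traversed completely; the \<open>t\<close> steps left over climb
      the tooth of \<open>v\<close>.\<close>
    define t where "t = k - h - nat_dist p q"
    have t: "t \<le> k" by (simp add: t_def)
    show thesis
    proof (rule that)
      show "col k (node k q t) < n" using n t by simp
      show "comb_dist k u (node k q t) = k"
        using du[of t q] False \<open>p \<noteq> q\<close> h t by (simp add: t_def)
      have "h + nat_dist p q + t = k" "t \<le> g" using assms(1) False d by (simp_all add: t_def)
      moreover from this have "comb_dist k (node k q t) v = g - t"
        using dv[of t q] t by (simp add: nat_dist_def)
      ultimately show "comb_dist k (node k q t) v = comb_dist k u v - k"
        using d by linarith
    qed
  qed
qed

section \<open>The power graph and its distance function\<close>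

definition comb_power :: "nat \<Rightarrow> nat \<Rightarrow> nat pair_pre_digraph" where
  "comb_power n k = \<lparr> pverts = {v. col k v < n},
     parcs = {(u, v). col k u < n \<and> col k v < n \<and> u \<noteq> v \<and> comb_dist k u v \<le> k} \<rparr>"

text \<open>For \<open>k \<ge> 1\<close> this is the tree distance divided by \<open>k\<close>,
  rounded up.\<close>

definition comb_power_dist :: "nat \<Rightarrow> nat \<Rightarrow> nat \<Rightarrow> nat" where
  "comb_power_dist k u v = (comb_dist k u v + k - 1) div k"

lemma pverts_comb_power: "v \<in> pverts (comb_power n k) \<longleftrightarrow> col k v < n"
  by (simp add: comb_power_def)

lemma pverts_comb_power_eq: "pverts (comb_power n k) = {..<n * Suc k}"
  by (auto simp: comb_power_def less_mult_imp_div_less div_less_iff_less_mult)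

lemma parcs_comb_power: "(u, v) \<in> parcs (comb_power n k) \<longleftrightarrow>
    col k u < n \<and> col k v < n \<and> u \<noteq> v \<and> comb_dist k u v \<le> k"
  by (simp add: comb_power_def)

lemma pair_graph_comb_power: "pair_graph (comb_power n k)"
proof
  have "parcs (comb_power n k) \<subseteq> pverts (comb_power n k) \<times> pverts (comb_power n k)"
    by (auto simp: comb_power_def)
  then show "finite (parcs (comb_power n k))"
    by (rule finite_subset) (simp add: pverts_comb_power_eq)
  show "symmetric (with_proj (comb_power n k))"
    by (auto simp: symmetric_def sym_def parcs_comb_power comb_dist_commute)
  show "finite (pverts (comb_power n k))" by (simp add: pverts_comb_power_eq)
qed (auto simp: comb_power_def)

text \<open>Serves twice: for the descent along a tree geodesic, and for comparing the end of a
  tooth with its foot.\<close>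

lemma comb_power_dist_Suc:
  assumes "comb_dist k u x = comb_dist k v x + k" "k \<ge> 1"
  shows "comb_power_dist k u x = Suc (comb_power_dist k v x)"
proof -
  have "comb_dist k u x + k - 1 = (comb_dist k v x + k - 1) + k"
    using assms by linarith
  moreover have "((comb_dist k v x + k - 1) + k) div k = Suc ((comb_dist k v x + k - 1) div k)"
    using assms(2) div_add_self2[of k "comb_dist k v x + k - 1"] by linarith
  ultimately show ?thesis by (simp only: comb_power_dist_def)
qed

text \<open>The arc condition is the tree triangle inequality with one term at most
  \<open>k\<close>. For the descent, go straight to \<open>v\<close> if it is within tree distance
  \<open>k\<close>, and otherwise to the vertex \<open>k\<close> steps along the geodesic.\<close>

lemma path_metric_comb_power:
  assumes "k \<ge> 1"
  shows "path_metric (comb_power n k) (comb_power_dist k)"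
  unfolding path_metric_def
proof (intro conjI ballI impI)
  fix v show "comb_power_dist k v v = 0"
    using assms by (simp add: comb_power_dist_def)
next
  fix e assume "e \<in> parcs (comb_power n k)"
  moreover have "comb_power_dist k u v \<le> Suc (comb_power_dist k w v)"
    if "comb_dist k u w \<le> k" for u w v
  proof -
    have "comb_dist k u v + k - 1 \<le> (comb_dist k w v + k - 1) + k"
      using comb_dist_triangle[of k u v w] that assms by linarith
    then have "(comb_dist k u v + k - 1) div k \<le> ((comb_dist k w v + k - 1) + k) div k"
      by (rule div_le_mono)
    also have "\<dots> = Suc ((comb_dist k w v + k - 1) div k)"
      using assms div_add_self2[of k "comb_dist k w v + k - 1"] by linarith
    finally show ?thesis by (simp only: comb_power_dist_def)
  qed
  ultimately show "case e of (u, w) \<Rightarrow>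
      \<forall>v\<in>pverts (comb_power n k). comb_power_dist k u v \<le> Suc (comb_power_dist k w v)"
    by (auto simp: parcs_comb_power)
next
  fix u v
  assume uv: "u \<in> pverts (comb_power n k)" "v \<in> pverts (comb_power n k)" "u \<noteq> v"
  show "\<exists>w. (u, w) \<in> parcs (comb_power n k) \<and>
      comb_power_dist k u v = Suc (comb_power_dist k w v)"
  proof (cases "comb_dist k u v \<le> k")
    case True
    have "comb_power_dist k u v = 1"
      unfolding comb_power_dist_def
      using True comb_dist_pos[OF uv(3), of k] assms by (intro div_nat_eqI) auto
    moreover have "comb_power_dist k v v = 0"
      using assms by (simp add: comb_power_dist_def)
    ultimately show ?thesis
      using uv True by (intro exI[of _ v]) (simp add: parcs_comb_power pverts_comb_power)
  next
    case False
    then obtain w where w: "col k w < n" "comb_dist k u w = k"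
      "comb_dist k w v = comb_dist k u v - k"
      using comb_dist_geodesic[of k u v n] uv by (auto simp: pverts_comb_power)
    have "comb_power_dist k u v = Suc (comb_power_dist k w v)"
      using w(3) False assms by (intro comb_power_dist_Suc) auto
    moreover have "u \<noteq> w" using w(2) assms by auto
    ultimately show ?thesis
      using uv w by (intro exI[of _ w]) (simp add: parcs_comb_power pverts_comb_power)
  qed
qed

section \<open>Connectivity of the power graph\<close>

lemma k_connected_comb_power:
  assumes "k \<ge> 1" "n \<ge> 1"
  shows "k_connected k (comb_power n k)"
  unfolding k_connected_def
proof (intro conjI allI impI)
  have "1 * Suc k \<le> n * Suc k" using assms(2) by (intro mult_le_mono1)
  then show card_V: "k < card (pverts (comb_power n k))"
    by (simp add: pverts_comb_power_eq)
  fix X assume X: "X \<subseteq> pverts (comb_power n k)" "card X < k"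
  define H where "H = delete_verts (comb_power n k) X"
  interpret G: pair_graph "comb_power n k" by (rule pair_graph_comb_power)
  have finX: "finite X" using X(1) G.pair_finite_verts finite_subset by blast
  have VH: "v \<in> pverts H \<longleftrightarrow> col k v < n \<and> v \<notin> X" for v
    by (simp add: H_def delete_verts_def pverts_comb_power)
  have EH: "(u, v) \<in> parcs H \<longleftrightarrow>
      u \<in> pverts H \<and> v \<in> pverts H \<and> u \<noteq> v \<and> comb_dist k u v \<le> k" for u v
    by (auto simp: H_def delete_verts_def pverts_comb_power parcs_comb_power)
  interpret H: pair_wf_digraph H by unfold_locales (auto simp: EH)
  have symH: "symmetric (with_proj H)"
    by (auto simp: symmetric_def sym_def EH comb_dist_commute)
  have reach: "u \<rightarrow>\<^sup>*\<^bsub>H\<^esub> v"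
    if "u \<in> pverts H" "v \<in> pverts H" "comb_dist k u v \<le> k" for u v
    using that by (cases "u = v") (auto simp: EH)
  \<comment> \<open>The two nodes are at tree distance \<open>h + 1 + (k - 1 - h) = k\<close>, so
    they are adjacent when both belong to the graph. The \<open>k\<close> pairs are disjoint, so
    fewer than \<open>k\<close> deletions leave one intact.\<close>
  have bridge: "\<exists>h<k. node k p h \<notin> X \<and> node k (Suc p) (k - 1 - h) \<notin> X" for p
  proof (rule ccontr)
    \<comment> \<open>\<open>e\<close> selects a deleted node from each pair. Its column shows which
      end was selected, and its height then recovers \<open>h\<close>.\<close>
    define e where "e h = (if node k p h \<in> X then node k p h else node k (Suc p) (k - 1 - h))" for h
    assume "\<not> ?thesis"
    then have "e ` {..<k} \<subseteq> X" by (auto simp: e_def)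
    moreover have "inj_on e {..<k}"
    proof (rule inj_onI)
      fix h h' assume hh: "h \<in> {..<k}" "h' \<in> {..<k}" "e h = e h'"
      then have "col k (e h) = col k (e h')" "ht k (e h) = ht k (e h')" by simp_all
      then show "h = h'" using hh(1,2) by (auto simp: e_def split: if_splits)
    qed
    ultimately have "card {..<k} \<le> card X" by (intro card_inj_on_le finX)
    with X(2) show False by simp
  qed
  \<comment> \<open>Surviving vertices of a tooth still form a clique, so an intact bridge extends
    reachability from tooth \<open>p\<close> to tooth \<open>Suc p\<close>.\<close>
  have from0: "u \<rightarrow>\<^sup>*\<^bsub>H\<^esub> v" if "u \<in> pverts H" "v \<in> pverts H" "col k u = 0" for u v
    using that(2)
  proof (induct "col k v" arbitrary: v)
    case 0
    then show ?case using reach[OF that(1)] comb_dist_col_le[of u k v] that(3) by simp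
  next
    case (Suc p)
    obtain h where h: "h < k" "node k p h \<notin> X" "node k (Suc p) (k - 1 - h) \<notin> X"
      using bridge by blast
    let ?a = "node k p h" and ?b = "node k (Suc p) (k - 1 - h)"
    have "Suc p < n" using Suc VH by simp
    then have ab: "?a \<in> pverts H" "?b \<in> pverts H" using h by (auto simp: VH)
    have "nat_dist p (Suc p) = 1" by (simp add: nat_dist_def)
    have "u \<rightarrow>\<^sup>*\<^bsub>H\<^esub> ?a" using Suc(1)[of ?a] ab h by simp
    also have "?a \<rightarrow>\<^sup>*\<^bsub>H\<^esub> ?b" using h \<open>nat_dist p (Suc p) = 1\<close>
      by (intro reach ab) (simp add: comb_dist_def)
    also have "?b \<rightarrow>\<^sup>*\<^bsub>H\<^esub> v"
      using h Suc by (intro reach ab comb_dist_col_le) auto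
    finally show ?case .
  qed
  have "\<exists>u\<in>pverts H. col k u = 0"
  proof -
    \<comment> \<open>The numbers up to \<open>k\<close> are the \<open>k + 1\<close> vertices of
      the first tooth, too many to be all deleted.\<close>
    have "\<not> {..k} \<subseteq> X" using card_mono[OF finX, of "{..k}"] X(2) by auto
    then obtain u where "u \<le> k" "u \<notin> X" by auto
    then show ?thesis using assms(2) by (intro bexI[of _ u]) (auto simp: VH)
  qed
  then obtain z where z: "z \<in> pverts H" "col k z = 0" by blast
  have "u \<rightarrow>\<^sup>*\<^bsub>H\<^esub> v" if "u \<in> pverts H" "v \<in> pverts H" for u v
  proof -
    have "u \<rightarrow>\<^sup>*\<^bsub>H\<^esub> z" using symmetric_reachable[OF symH from0[OF z(1) that(1) z(2)]] .
    also have "z \<rightarrow>\<^sup>*\<^bsub>H\<^esub> v" using from0[OF z(1) that(2) z(2)] .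
    finally show ?thesis .
  qed
  then have "Digraph_Component.connected (with_proj H)"
    unfolding Digraph_Component.connected_def strongly_connected_def
    using z(1) H.reachable_mk_symmetricI by auto
  then show "Digraph_Component.connected (with_proj (delete_verts (comb_power n k) X))"
    by (simp add: H_def)
qed

section \<open>Upper bound for the metric dimension of the power graph\<close>

text \<open>Distances to the \<open>k\<close> landmarks of a tooth have this rounded form, with
  \<open>s\<close> the landmark height. Rounding loses nothing over a full window of
  \<open>k\<close> shifts: where the smaller number reaches a multiple of \<open>k\<close>, the
  larger one is already rounded up further.\<close>

lemma ceiling_div_window_inj:
  fixes a b k :: nat
  assumes "\<And>s. s \<in> {1..k} \<Longrightarrow> (a + s + k - 1) div k = (b + s + k - 1) div k" "k \<ge> 1"
  shows "a = b"
proof -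
  have "\<not> x < y" if eq: "\<And>s. s \<in> {1..k} \<Longrightarrow> (x + s + k - 1) div k = (y + s + k - 1) div k" for x y
  proof
    assume "x < y"
    \<comment> \<open>Choose \<open>s\<close> such that \<open>x + s\<close> is a multiple of \<open>k\<close>: there the ceiling jumps.\<close>
    define s where "s = k - x mod k"
    have "x mod k < k" using assms(2) by simp
    then have s: "s \<in> {1..k}" by (auto simp: s_def)
    define m where "m = Suc (x div k)"
    have "x mod k + s = k" using \<open>x mod k < k\<close> by (simp add: s_def)
    then have xs: "x + s = k * m"
      unfolding m_def mult_Suc_right by (metis add.assoc add.commute mult_div_mod_eq)
    have "(x + s + k - 1) div k = m"
      using xs assms(2) by (intro div_nat_eqI) (auto simp: algebra_simps)
    \<comment> \<open>Since \<open>y + s\<close> is at least \<open>k * m + 1\<close>, adding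
      \<open>k - 1\<close> reaches the next multiple of \<open>k\<close>.\<close>
    moreover have "k * Suc m div k \<le> (y + s + k - 1) div k"
      using xs \<open>x < y\<close> by (intro div_le_mono) simp
    moreover have "k * Suc m div k = Suc m"
      using assms(2) by (intro nonzero_mult_div_cancel_left) simp
    ultimately show False using eq[OF s] by simp
  qed
  from this[of a b] this[of b a] show ?thesis using assms(1) by (metis linorder_neqE_nat)
qed

lemma metric_dim_comb_power_le:
  assumes "k \<ge> 1" "n \<ge> 2"
  shows "metric_dim (comb_power n k) \<le> 2 * k"
proof -
  define S where "S = node k 0 ` {1..k} \<union> node k (n - 1) ` {1..k}"
  interpret G: pair_graph "comb_power n k" by (rule pair_graph_comb_power)
  have SV: "S \<subseteq> pverts (comb_power n k)"
    using assms by (auto simp: S_def pverts_comb_power)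
  \<comment> \<open>A landmark is the only vertex at distance 0 from itself, so an unresolved pair
    lies outside \<open>S\<close>.\<close>
  have self: "u = v" if "u \<in> S" "comb_power_dist k v u = comb_power_dist k u u" for u v
    using that assms comb_dist_pos[of v u k] by (force simp: comb_power_dist_def div_eq_0_iff)
  have "\<exists>x\<in>S. resolves (comb_power n k) x u v"
    if uv: "u \<in> pverts (comb_power n k)" "v \<in> pverts (comb_power n k)" "u \<noteq> v" for u v
  proof (rule ccontr)
    assume "\<not> ?thesis"
    then have eq: "comb_power_dist k u x = comb_power_dist k v x" if "x \<in> S" for x
      using resolves_path_metric[OF G.pair_wf_digraph_axioms path_metric_comb_power[OF assms(1)]]
        SV that uv by blast
    have uv': "col k u < n" "col k v < n" using uv by (simp_all add: pverts_comb_power)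
    have "u \<notin> S" "v \<notin> S" using self[of u v] self[of v u] eq uv(3) by auto
    \<comment> \<open>A vertex of an outer tooth that is not a landmark lies on the spine.\<close>
    have low: "comb_dist k w (node k 0 s) = col k w + ht k w + s"
      if "w \<notin> S" "s \<in> {1..k}" for w s
    proof -
      have "ht k w = 0" if "col k w = 0"
        using \<open>w \<notin> S\<close> that node_col_ht[of k w] ht_le[of w k] unfolding S_def
        by (metis Suc_le_eq UnI1 atLeastAtMost_iff imageI neq0_conv One_nat_def)
      then show ?thesis using \<open>s \<in> {1..k}\<close> by (auto simp: comb_dist_def)
    qed
    have high: "comb_dist k w (node k (n - 1) s) = (n - 1 - col k w) + ht k w + s"
      if "w \<notin> S" "s \<in> {1..k}" "col k w < n" for w s
    proof -
      have "ht k w = 0" if "col k w = n - 1"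
        using \<open>w \<notin> S\<close> that node_col_ht[of k w] ht_le[of w k] unfolding S_def
        by (metis Suc_le_eq UnI2 atLeastAtMost_iff imageI neq0_conv One_nat_def)
      moreover have "nat_dist (col k w) (n - 1) = n - 1 - col k w"
        using \<open>col k w < n\<close> by (simp add: nat_dist_def)
      ultimately show ?thesis using \<open>s \<in> {1..k}\<close> by (auto simp: comb_dist_def)
    qed
    have "col k u + ht k u = col k v + ht k v"
    proof (rule ceiling_div_window_inj[OF _ assms(1)])
      fix s assume s: "s \<in> {1..k}"
      then have "node k 0 s \<in> S" by (simp add: S_def)
      from eq[OF this] show "(col k u + ht k u + s + k - 1) div k = (col k v + ht k v + s + k - 1) div k"
        by (simp only: comb_power_dist_def low[OF \<open>u \<notin> S\<close> s] low[OF \<open>v \<notin> S\<close> s])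
    qed
    moreover have "(n - 1 - col k u) + ht k u = (n - 1 - col k v) + ht k v"
    proof (rule ceiling_div_window_inj[OF _ assms(1)])
      fix s assume s: "s \<in> {1..k}"
      then have "node k (n - 1) s \<in> S" by (simp add: S_def)
      from eq[OF this] show "(n - 1 - col k u + ht k u + s + k - 1) div k =
          (n - 1 - col k v + ht k v + s + k - 1) div k"
        by (simp only: comb_power_dist_def high[OF \<open>u \<notin> S\<close> s uv'(1)]
            high[OF \<open>v \<notin> S\<close> s uv'(2)])
    qed
    \<comment> \<open>Sum and difference of column and height determine both; the bounds in
      \<open>uv'\<close> ensure that the subtractions from \<open>n - 1\<close> are not
      truncated.\<close>
    ultimately have "col k u = col k v" "ht k u = ht k v"
      using uv' by linarith+
    then show False using comb_vertex_eqI uv(3) by blast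
  qed
  then have "resolving_set (comb_power n k) S"
    using SV by (simp add: resolving_set_def)
  then have "metric_dim (comb_power n k) \<le> card S"
    by (intro metric_dim_le) (simp add: S_def)
  also have "\<dots> \<le> card (node k 0 ` {1..k}) + card (node k (n - 1) ` {1..k})"
    unfolding S_def by (rule card_Un_le)
  also have "\<dots> \<le> k + k"
    using card_image_le[of "{1..k}"] by (intro add_mono) simp_all
  finally show ?thesis by simp
qed

section \<open>Lower bound for the square of the power graph\<close>

lemma metric_dim_square_comb_power_ge:
  assumes "k \<ge> 1"
  shows "n \<le> metric_dim (comb_power n k \<box> comb_power n k)"
proof (rule metric_dim_square_ge[OF pair_graph_comb_power path_metric_comb_power[OF assms]])
  \<comment> \<open>The foot is excluded from \<open>A i\<close>: from it, as from every vertex off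
    the tooth, the end of the tooth is exactly \<open>k\<close> tree steps farther than the foot,
    which is exactly one step in the power.\<close>
  define A where "A i = {v. col k v = i \<and> 0 < ht k v}" for i
  show "disjoint_family_on A {..<n}"
    by (auto simp: A_def disjoint_family_on_def)
  show "node k i k \<in> pverts (comb_power n k)" "node k i 0 \<in> pverts (comb_power n k)"
    if "i < n" for i
    using that by (simp_all add: pverts_comb_power)
  show "node k i k \<noteq> node k i 0" if "i < n" for i
    using assms by (simp add: node_def)
  show "comb_power_dist k (node k i k) x = Suc (comb_power_dist k (node k i 0) x)"
    if "x \<notin> A i" for i x
    by (rule comb_power_dist_Suc[OF _ assms]) (use that in \<open>auto simp: comb_dist_def A_def\<close>)
qed

theorem theorem9p4:
  fixes k n :: nat
  assumes "k \<ge> 1" and "n \<ge> 2"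
  shows "\<exists>G :: nat pair_pre_digraph.
    pair_graph G \<and> k_connected k G \<and> metric_dim G \<le> 2 * k \<and> metric_dim (G \<box> G) \<ge> n"
proof (intro exI conjI)
  show "pair_graph (comb_power n k)" by (rule pair_graph_comb_power)
  show "k_connected k (comb_power n k)" using assms by (intro k_connected_comb_power) auto
  show "metric_dim (comb_power n k) \<le> 2 * k" by (rule metric_dim_comb_power_le[OF assms])
  show "n \<le> metric_dim (comb_power n k \<box> comb_power n k)"
    by (rule metric_dim_square_comb_power_ge[OF assms(1)])
qed

end
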